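(* For all integers $n\geq 0$, $$pend(27n+19) \equiv 0 \pmod{3}.$$
   Context: A PEND partition is an integer partition in which the even parts are not allowed to be distinct, i.e., no even part appears with multiplicity exactly one (every even part that occurs appears at least twice), while the odd parts are unrestricted. For an integer $n\geq 0$, $pend(n)$ denotes the number of PEND partitions of weight $n$, i.e., PEND partitions whose parts sum to $n$ (the empty partition is counted, so $pend(0)=1$). *)

theory Defs
  imports "HOL-Library.Multiset" "HOL-Number_Theory.Cong"
begin

text \<open>An integer partition of \<open>n\<close> is represented by the multiset of its parts.\<close>

definition is_partition :: "nat \<Rightarrow> nat multiset \<Rightarrow> bool" where
  "is_partition n M \<longleftrightarrow> (\<forall>k \<in># M. k > 0) \<and> \<Sum>\<^sub># M = n"

definition is_PEND :: "nat multiset \<Rightarrow> bool" where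
  "is_PEND M \<longleftrightarrow> (\<forall>k \<in># M. even k \<longrightarrow> count M k \<noteq> 1)"

definition pend :: "nat \<Rightarrow> nat" where
  "pend n = card {M. is_partition n M \<and> is_PEND M}"

lemma size_le_sum_mset:
  fixes M :: "nat multiset"
  assumes "\<forall>k \<in># M. k > 0"
  shows "size M \<le> \<Sum>\<^sub># M"
  using assms by (induction M) auto

text \<open>The set counted by \<open>pend n\<close> is finite, so its \<open>card\<close> is meaningful.\<close>

lemma finite_partitions: "finite {M. is_partition n M}"
proof (rule finite_subset)
  show "{M. is_partition n M} \<subseteq> mset ` {xs. set xs \<subseteq> {..n} \<and> length xs \<le> n}"
  proof
    fix M assume "M \<in> {M. is_partition n M}"
    then have M: "\<forall>k \<in># M. k > 0" "\<Sum>\<^sub># M = n"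
      by (auto simp: is_partition_def)
    obtain xs where xs: "M = mset xs"
      by (metis ex_mset)
    have "length xs \<le> n"
      using size_le_sum_mset[OF M(1)] M(2) xs by simp
    moreover have "set xs \<subseteq> {..n}"
      using M(2) xs by (auto simp: sum_mset_sum_list member_le_sum_list)
    ultimately show "M \<in> mset ` {xs. set xs \<subseteq> {..n} \<and> length xs \<le> n}"
      using xs by blast
  qed
  show "finite (mset ` {xs. set xs \<subseteq> {..n} \<and> length xs \<le> n})"
    by (intro finite_imageI finite_lists_length_le) simp
qed

lemma finite_PEND_partitions: "finite {M. is_partition n M \<and> is_PEND M}"
  using finite_partitions[of n] by (rule rev_finite_subset) blast

lemma pend_0: "pend 0 = 1"
proof -
  have "{M. is_partition 0 M \<and> is_PEND M} = {{#}}"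
    by (auto simp: is_partition_def is_PEND_def dest: size_le_sum_mset)
       (metis less_numeral_extra(3) multiset_nonemptyE)
  then show ?thesis
    by (simp add: pend_def)
qed

end

theory Submission
  imports Defs "HOL-Library.Nat_Bijection" "HOL-Computational_Algebra.Formal_Power_Series"
    "Berlekamp_Zassenhaus.Finite_Field"
begin

text \<open>
  Work over the field with three elements. An even part \<open>k\<close> contributes the factor
  \<open>(1 - q^k + q^(2k)) / (1 - q^k) = (1 + q^k)\<^sup>2 / (1 - q^k)\<close>, so by Gauss' product formulas for
  \<open>\<psi>(q) = \<Sum> q^(k(k+1)/2)\<close> and \<open>\<Phi>(q) = \<phi>(-q\<^sup>2) = 1 + 2 \<Sum> (-1)^k q^(2k\<^sup>2)\<close> the generating function
  \<open>F\<close> of \<open>pend\<close> satisfies \<open>F \<Phi>\<^sup>2 = \<psi>\<close>, hence \<open>F(q) \<Phi>(q^3) = \<psi>(q) \<Phi>(q)\<close>. Let \<open>T\<^sub>r\<close> extract the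
  coefficients with index \<open>r\<close> modulo 3. Since \<open>T\<^sub>1 \<psi> = \<psi>(q^3)\<close>, \<open>T\<^sub>2 \<psi> = 0\<close>, \<open>T\<^sub>0 \<Phi> = \<Phi>(q^3)\<close> and
  \<open>T\<^sub>1 \<Phi> = 0\<close>, we get \<open>T\<^sub>1 F = \<psi>(q^3) \<Phi>\<^sup>2\<close>, then \<open>T\<^sub>0 T\<^sub>1 F = \<psi> \<Phi>(q^3)\<^sup>2\<close>, and finally
  \<open>T\<^sub>2 T\<^sub>0 T\<^sub>1 F = \<Phi>\<^sup>2 T\<^sub>2 \<psi> = 0\<close>. Gauss' formulas are limits of finite identities of Shanks, which
  telescope.
\<close>

unbundle fps_syntax

section \<open>Sections of power series modulo 3\<close>

definition trisect :: "nat \<Rightarrow> 'a::zero fps \<Rightarrow> 'a fps" where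
  "trisect r f = Abs_fps (\<lambda>n. f $ (3 * n + r))"

definition dilate :: "'a::zero fps \<Rightarrow> 'a fps" where
  "dilate f = Abs_fps (\<lambda>n. if 3 dvd n then f $ (n div 3) else 0)"

lemma trisect_nth [simp]: "trisect r f $ n = f $ (3 * n + r)"
  by (simp add: trisect_def)

lemma dilate_nth [simp]: "dilate f $ n = (if 3 dvd n then f $ (n div 3) else 0)"
  by (simp add: dilate_def)

lemma trisect_add: "trisect r (f + g) = trisect r f + trisect r (g :: 'a::comm_ring_1 fps)"
  by (simp add: fps_eq_iff)

text \<open>A dilated factor lives on multiples of 3, so it never changes the residue of an index.
  The bound \<open>r < 3\<close> confines these multiples to \<open>3 * j\<close> with
  \<open>j <= n\<close>.\<close>

lemma trisect_dilate_mult: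
  fixes f g :: "'a::comm_ring_1 fps"
  assumes "r < 3"
  shows "trisect r (dilate f * g) = f * trisect r g"
proof (rule fps_ext)
  fix n
  have "trisect r (dilate f * g) $ n = (\<Sum>i=0..3*n+r. dilate f $ i * g $ (3*n+r-i))"
    by (simp only: trisect_nth fps_mult_nth)
  also have "\<dots> = (\<Sum>i\<in>(\<lambda>j. 3*j) ` {0..n}. dilate f $ i * g $ (3*n+r-i))"
  proof (rule sum.mono_neutral_right)
    have "i \<in> (\<lambda>j. 3*j) ` {0..n}" if "i \<le> 3*n+r" "3 dvd i" for i
      using that assms by (intro image_eqI[of _ _ "i div 3"]) auto
    then show "\<forall>i\<in>{0..3*n+r} - (\<lambda>j. 3*j) ` {0..n}. dilate f $ i * g $ (3*n+r-i) = 0"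
      by auto
  qed auto
  also have "\<dots> = (\<Sum>j=0..n. f $ j * g $ (3*(n-j)+r))"
    by (subst sum.reindex) (auto simp: inj_on_def diff_mult_distrib2 intro!: sum.cong)
  also have "\<dots> = (f * trisect r g) $ n"
    by (simp add: fps_mult_nth)
  finally show "trisect r (dilate f * g) $ n = (f * trisect r g) $ n" .
qed

lemma trisect_X_mult:
  fixes f :: "'a::comm_ring_1 fps"
  shows "trisect 0 (fps_X * f) = fps_X * trisect 2 f"
    and "trisect (Suc r) (fps_X * f) = trisect r f"
proof -
  have "3 * n - Suc 0 = 3 * (n - Suc 0) + 2" if "n > 0" for n :: nat
    using that by simp
  then show "trisect 0 (fps_X * f) = fps_X * trisect 2 f"
    by (auto simp: fps_eq_iff)
  show "trisect (Suc r) (fps_X * f) = trisect r f"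
    by (simp add: fps_eq_iff)
qed

lemma trisection:
  fixes f :: "'a::comm_ring_1 fps"
  shows "f = dilate (trisect 0 f) + fps_X * dilate (trisect 1 f)
             + fps_X * (fps_X * dilate (trisect 2 f))" (is "_ = ?rhs")
proof (rule fps_ext)
  fix n :: nat
  obtain m r where n: "n = 3 * m + r" and "r < 3"
    by (metis mult_div_mod_eq mod_less_divisor zero_less_numeral)
  then have "r = 0 \<or> r = 1 \<or> r = 2" by auto
  moreover have "\<not> 3 dvd 3 * m + Suc 0" "\<not> 3 dvd Suc (3 * m + Suc 0)" by presburger+
  moreover have "\<not> 3 dvd 3 * m - Suc 0" "\<not> 3 dvd 3 * m - Suc (Suc 0)" if "m > 0"
    using that by presburger+
  ultimately show "f $ n = ?rhs $ n"
    by (auto simp: n numeral_2_eq_2)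
qed

text \<open>Once \<open>f\<close> is split by \<open>trisection\<close>, its sections can be pulled
  out. Residue pairs whose sum exceeds the target by 3 carry over, hence the factor
  \<open>fps_X\<close>.\<close>

lemma trisect_mult:
  fixes f g :: "'a::comm_ring_1 fps"
  shows "trisect 0 (f * g) = trisect 0 f * trisect 0 g
           + fps_X * (trisect 1 f * trisect 2 g + trisect 2 f * trisect 1 g)"
    and "trisect 1 (f * g) = trisect 0 f * trisect 1 g + trisect 1 f * trisect 0 g
           + fps_X * (trisect 2 f * trisect 2 g)"
proof -
  have "f * g = dilate (trisect 0 f) * g + dilate (trisect 1 f) * (fps_X * g)
          + dilate (trisect 2 f) * (fps_X * (fps_X * g))"
    by (subst trisection[of f]) (simp add: algebra_simps)
  then have *: "trisect r (f * g) = trisect 0 f * trisect r g + trisect 1 f * trisect r (fps_X * g)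
          + trisect 2 f * trisect r (fps_X * (fps_X * g))" if "r < 3" for r
    using that by (simp add: trisect_add trisect_dilate_mult)
  show "trisect 0 (f * g) = trisect 0 f * trisect 0 g
           + fps_X * (trisect 1 f * trisect 2 g + trisect 2 f * trisect 1 g)"
    using *[of 0] by (simp add: trisect_X_mult numeral_2_eq_2 algebra_simps)
  show "trisect 1 (f * g) = trisect 0 f * trisect 1 g + trisect 1 f * trisect 0 g
           + fps_X * (trisect 2 f * trisect 2 g)"
    using *[of 1] by (simp add: trisect_X_mult numeral_2_eq_2 algebra_simps)
qed

text \<open>Cubing is additive in characteristic 3 and fixes coefficients. With the constant term
  peeled off, \<open>f = c + X g\<close> gives \<open>f^3 = c + X^3 g^3\<close>, a recursion that
  \<open>dilate\<close> obeys too.\<close>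

lemma cube_eq_dilate:
  fixes f :: "'a::comm_ring_1 fps"
  assumes three: "(3 :: 'a) = 0" and cube: "\<And>a :: 'a. a ^ 3 = a"
  shows "f ^ 3 = dilate f"
proof (rule fps_ext)
  fix n
  show "(f ^ 3) $ n = dilate f $ n"
  proof (induction n arbitrary: f rule: less_induct)
    case (less n)
    define c g where "c = fps_const (f $ 0)" and "g = fps_shift 1 f"
    have f: "f = c + fps_X * g"
      by (auto simp: c_def g_def fps_eq_iff)
    have three': "(3 :: 'a fps) = 0"
      using three by (simp add: numeral_fps_const)
    have "f ^ 3 = c ^ 3 + fps_X ^ 3 * g ^ 3 + 3 * (c * fps_X * g * (c + fps_X * g))"
      unfolding f by (simp add: power3_eq_cube algebra_simps)
    also have "c ^ 3 = c"
      by (simp add: c_def cube)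
    finally have f3: "f ^ 3 = c + fps_X ^ 3 * g ^ 3"
      by (simp add: three')
    show ?case
    proof (cases "n < 3")
      case True
      then show ?thesis
        by (cases "n = 0") (auto simp: f3 c_def fps_X_power_mult_nth dest: dvd_imp_le)
    next
      case False
      then have "(g ^ 3) $ (n - 3) = dilate g $ (n - 3)"
        by (intro less.IH) simp
      moreover have "3 dvd n - 3 \<longleftrightarrow> 3 dvd n" "Suc ((n - 3) div 3) = n div 3"
        using False by presburger+
      ultimately show ?thesis
        using False by (simp add: f3 c_def fps_X_power_mult_nth g_def)
    qed
  qed
qed

section \<open>Two finite identities of Shanks\<close>

text \<open>Up to a constant, \<open>P n\<close> is the product of (1 - x^(2i+2)) / (1 - x^(2i+1))
  over i < n; its inverse \<open>R n\<close> avoids division. The term \<open>s = 0\<close> carries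
  the product, the others have high order in x.\<close>

lemma shanks_triangle:
  fixes x :: "'a::idom" and P R :: "nat \<Rightarrow> 'a"
  assumes PR: "\<And>n. P n * R n = 1"
    and step: "\<And>n. P (Suc n) * (1 - x ^ (2*n+1)) = P n * (1 - x ^ (2*n+2))"
    and nz: "\<And>n. n > 0 \<Longrightarrow> x ^ n \<noteq> 1"
  shows "P n * (\<Sum>s<n. R s * x ^ (s * (2*n+1))) = (\<Sum>k<2*n. x ^ triangle k)"
proof (induction n)
  case 0
  then show ?case by simp
next
  case (Suc n)
  define b where "b = 1 - x ^ (2*n+1)"
  have b: "b \<noteq> 0" using nz[of "2*n+1"] by (simp add: b_def)
  have Rstep: "R (Suc s) * (1 - x ^ (2*s+2)) = R s * (1 - x ^ (2*s+1))" for s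
  proof -
    have "R (Suc s) * (1 - x ^ (2*s+2)) = (P s * R s) * (R (Suc s) * (1 - x ^ (2*s+2)))"
      by (simp add: PR)
    also have "\<dots> = (P s * (1 - x ^ (2*s+2))) * (R s * R (Suc s))"
      by (simp only: ac_simps)
    also have "\<dots> = (P (Suc s) * R (Suc s)) * (R s * (1 - x ^ (2*s+1)))"
      unfolding step[of s, symmetric] by (simp only: ac_simps)
    finally show ?thesis by (simp only: PR mult_1_left)
  qed
  \<comment> \<open>Telescoping certificate: once \<open>b\<close> clears the denominator of
    \<open>P (Suc n)\<close>, the summands common to both sums become
    \<open>u (Suc s) - u s\<close>. The factor 1 - x^0 makes \<open>u 0 = 0\<close>.\<close>
  define u where "u s = R s * (1 - x ^ (2*s)) * x ^ (s * (2*n+1))" for s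
  have u: "u (Suc s) = R s * (1 - x ^ (2*s+1)) * x ^ (Suc s * (2*n+1))" for s
    using Rstep[of s] by (simp add: u_def)
  have diff: "R s * ((1 - x ^ (2*n+2)) * x ^ (s * (2*n+3)) - b * x ^ (s * (2*n+1)))
      = u (Suc s) - u s" for s
    unfolding u
    by (simp add: u_def b_def algebra_simps power_add power_mult power2_eq_square power3_eq_cube)
  have tele: "(\<Sum>s<n. u (Suc s) - u s) = u n"
    by (subst sum_lessThan_telescope) (simp add: u_def)
  have tri: "n * (2*n+1) = triangle (2*n)" "Suc n * (2*n+1) = triangle (Suc (2*n))"
    by (simp_all add: triangle_def)
  have "b * (P (Suc n) * (\<Sum>s<Suc n. R s * x ^ (s * (2*Suc n+1)))
             - P n * (\<Sum>s<n. R s * x ^ (s * (2*n+1))))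
      = P n * ((1 - x ^ (2*n+2)) * (\<Sum>s<Suc n. R s * x ^ (s * (2*n+3)))
              - b * (\<Sum>s<n. R s * x ^ (s * (2*n+1))))"
  proof -
    have *: "b * (P (Suc n) * X - P n * Y) = P n * ((1 - x ^ (2*n+2)) * X - b * Y)" for X Y
    proof -
      have "b * (P (Suc n) * X - P n * Y) = (P (Suc n) * b) * X - P n * (b * Y)"
        by (simp add: algebra_simps)
      also have "\<dots> = P n * ((1 - x ^ (2*n+2)) * X - b * Y)"
        unfolding b_def step by (simp add: algebra_simps)
      finally show ?thesis .
    qed
    have "2 * Suc n + 1 = 2 * n + 3" by simp
    then show ?thesis by (simp only: *)
  qed
  also have "\<dots> = P n * (R n * (1 - x ^ (2*n+2)) * x ^ (n * (2*n+3))
        + (\<Sum>s<n. R s * ((1 - x ^ (2*n+2)) * x ^ (s * (2*n+3)) - b * x ^ (s * (2*n+1)))))"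
    by (simp add: sum_distrib_left sum_subtractf sum.distrib algebra_simps)
  also have "\<dots> = (P n * R n) * ((1 - x ^ (2*n+2)) * x ^ (n * (2*n+3))
                              + (1 - x ^ (2*n)) * x ^ (n * (2*n+1)))"
    unfolding diff tele by (simp add: u_def algebra_simps)
  \<comment> \<open>The bracket collapses to x^(n(2n+1)) (1 - x^(2(2n+1))), a difference of squares
    divisible by \<open>b\<close>. By \<open>tri\<close>, the two exponents left are the next two
    triangular numbers.\<close>
  also have "\<dots> = b * (x ^ (n * (2*n+1)) + x ^ (Suc n * (2*n+1)))"
    unfolding PR
    by (simp add: b_def algebra_simps power_add power_mult power2_eq_square power3_eq_cube)
  finally have "P (Suc n) * (\<Sum>s<Suc n. R s * x ^ (s * (2*Suc n+1)))
      - P n * (\<Sum>s<n. R s * x ^ (s * (2*n+1))) = x ^ (n * (2*n+1)) + x ^ (Suc n * (2*n+1))"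
    unfolding mult_left_cancel[OF b] .
  then have "P (Suc n) * (\<Sum>s<Suc n. R s * x ^ (s * (2*Suc n+1)))
      = (\<Sum>k<2*n. x ^ triangle k) + (x ^ triangle (2*n) + x ^ triangle (Suc (2*n)))"
    unfolding Suc.IH tri diff_eq_eq by (simp only: add.commute)
  also have "\<dots> = (\<Sum>k<2 * Suc n. x ^ triangle k)"
    by (simp only: mult_Suc_right add_2_eq_Suc sum.lessThan_Suc add.assoc)
  finally show ?case .
qed

text \<open>The same scheme, with \<open>Q n\<close> the product of (1 - x^i) / (1 + x^i) for i =
  1..n. The term of index 0 lacks the factor 2 and stands apart as the leading 1, hence the
  \<open>Suc\<close> shifts.\<close>

lemma shanks_square:
  fixes x :: "'a::idom" and Q R w :: "nat \<Rightarrow> 'a"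
  assumes Q0: "Q 0 = 1" and QR: "\<And>n. Q n * R n = 1"
    and w: "\<And>s. w (Suc s) * (1 - x ^ Suc s) = R s"
    and step: "\<And>n. Q (Suc n) * (1 + x ^ Suc n) = Q n * (1 - x ^ Suc n)"
    and nz: "\<And>n. 1 + x ^ Suc n \<noteq> 0"
  shows "Q n * (1 + 2 * (\<Sum>s<n. (-1) ^ Suc s * w (Suc s) * x ^ (Suc s * (n+1))))
         = 1 + 2 * (\<Sum>k<n. (-1) ^ Suc k * x ^ (Suc k)\<^sup>2)"
proof (induction n)
  case 0
  then show ?case by (simp add: Q0)
next
  case (Suc n)
  define y where "y = x ^ Suc n"
  have y: "1 + y \<noteq> 0" using nz[of n] by (simp add: y_def)
  \<comment> \<open>For s >= 1, \<open>w s\<close> is both \<open>R (s-1)\<close> / (1 - x^s) and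
    \<open>R s\<close> / (1 + x^s); telescoping needs both forms.\<close>
  have Rstep: "w (Suc s) * (1 + x ^ Suc s) = R (Suc s)" for s
  proof -
    have "w (Suc s) * (1 + x ^ Suc s) = (Q (Suc s) * R (Suc s)) * (w (Suc s) * (1 + x ^ Suc s))"
      by (simp only: QR mult_1)
    also have "\<dots> = (Q (Suc s) * (1 + x ^ Suc s)) * w (Suc s) * R (Suc s)"
      by (simp only: ac_simps)
    also have "\<dots> = Q s * (w (Suc s) * (1 - x ^ Suc s)) * R (Suc s)"
      by (simp only: step ac_simps)
    finally show ?thesis by (simp only: w mult.assoc[symmetric] QR mult_1)
  qed
  \<comment> \<open>Certificate for this sum. Its end \<open>v 0 = y\<close> cancels against the
    contribution of the leading 1s, and \<open>v n\<close> combines with the new term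
    \<open>C\<close> below into a multiple of 1 + y.\<close>
  define v where "v s = (-1) ^ s * y ^ Suc s * R s" for s
  have xy: "x ^ (Suc s * (n+1)) = y ^ Suc s" for s
    by (simp only: y_def Suc_eq_plus1 power_mult[symmetric] mult.commute)
  have xy': "x ^ (Suc s * (Suc n+1)) = y ^ Suc s * x ^ Suc s" for s
    unfolding xy[symmetric] power_add[symmetric] by (simp add: algebra_simps)
  have diff: "(-1) ^ Suc s * w (Suc s) * ((1 - y) * (y ^ Suc s * x ^ Suc s) - (1 + y) * y ^ Suc s)
      = v s - v (Suc s)" for s
  proof -
    have "(-1) ^ Suc s * w (Suc s) * ((1 - y) * (y ^ Suc s * x ^ Suc s) - (1 + y) * y ^ Suc s)
       = (-1) ^ s * y ^ Suc s * (w (Suc s) * (1 - x ^ Suc s) + y * (w (Suc s) * (1 + x ^ Suc s)))"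
      by (simp add: algebra_simps)
    then show ?thesis
      unfolding w Rstep by (simp add: v_def algebra_simps)
  qed
  have tele: "(\<Sum>s<n. v s - v (Suc s)) = y - v n"
    using QR[of 0] by (subst sum_lessThan_telescope') (simp add: v_def Q0)
  define A where "A = (\<Sum>s<n. (-1) ^ Suc s * w (Suc s) * (y ^ Suc s * x ^ Suc s))"
  define B where "B = (\<Sum>s<n. (-1) ^ Suc s * w (Suc s) * y ^ Suc s)"
  have AB: "(1 - y) * A - (1 + y) * B = y - v n"
    unfolding tele[symmetric] diff[symmetric]
    by (simp only: A_def B_def sum_distrib_left sum_subtractf[symmetric])
       (intro sum.cong refl; simp add: algebra_simps)
  define C where "C = (-1) ^ Suc n * w (Suc n) * (y ^ Suc n * x ^ Suc n)"
  have C: "(1 - y) * C = - ((-1) ^ n * R n * (y ^ Suc n * y))"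
    unfolding w[symmetric] C_def y_def[symmetric] by (simp add: algebra_simps)
  have "(1 + y) * (Q (Suc n) * (1 + 2 * (A + C)) - Q n * (1 + 2 * B))
      = (Q (Suc n) * (1 + y)) * (1 + 2 * (A + C)) - Q n * ((1 + y) * (1 + 2 * B))"
    by (simp add: algebra_simps)
  also have "\<dots> = Q n * ((1 - y) * (1 + 2 * (A + C)) - (1 + y) * (1 + 2 * B))"
    unfolding step[of n, folded y_def] by (simp add: algebra_simps)
  also have "\<dots> = Q n * (2 * (((1 - y) * A - (1 + y) * B) - y + (1 - y) * C))"
    by (simp add: algebra_simps)
  also have "\<dots> = (Q n * R n) * (2 * (- ((-1) ^ n) * y ^ Suc n * (1 + y)))"
    unfolding AB C v_def by (simp add: algebra_simps)
  also have "\<dots> = (1 + y) * (2 * ((-1) ^ Suc n * y ^ Suc n))"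
    unfolding QR by simp
  finally have "Q (Suc n) * (1 + 2 * (A + C)) - Q n * (1 + 2 * B) = 2 * ((-1) ^ Suc n * y ^ Suc n)"
    using y by (metis mult_left_cancel)
  then have "Q (Suc n) * (1 + 2 * (A + C)) = Q n * (1 + 2 * B) + 2 * ((-1) ^ Suc n * y ^ Suc n)"
    by (simp only: diff_eq_eq add.commute)
  also have "y ^ Suc n = x ^ (Suc n)\<^sup>2"
    by (simp only: y_def power_mult[symmetric] power2_eq_square)
  also have "Q n * (1 + 2 * B) = 1 + 2 * (\<Sum>k<n. (-1) ^ Suc k * x ^ (Suc k)\<^sup>2)"
    using Suc.IH by (simp only: xy B_def)
  finally have "Q (Suc n) * (1 + 2 * (A + C))
      = 1 + 2 * (\<Sum>k<Suc n. (-1) ^ Suc k * x ^ (Suc k)\<^sup>2)"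
    by (simp only: sum.lessThan_Suc distrib_left add.assoc)
  then show ?case
    unfolding xy' by (simp only: A_def C_def sum.lessThan_Suc)
qed

section \<open>Theta series as limits of products\<close>

text \<open>Each coefficient of a product involves only finitely many coefficients of the
  factors.\<close>

lemma tendsto_fps_mult:
  fixes f g :: "'b \<Rightarrow> 'a::comm_ring_1 fps"
  assumes "(f \<longlongrightarrow> a) F" "(g \<longlongrightarrow> b) F"
  shows "((\<lambda>x. f x * g x) \<longlongrightarrow> a * b) F"
proof (rule tendsto_fpsI)
  fix n
  have "eventually (\<lambda>x. \<forall>i\<in>{..n}. f x $ i = a $ i) F" "eventually (\<lambda>x. \<forall>i\<in>{..n}. g x $ i = b $ i) F"
    using assms by (simp_all add: eventually_ball_finite_distrib tendsto_fps_iff)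
  then show "eventually (\<lambda>x. (f x * g x) $ n = (a * b) $ n) F"
    by eventually_elim (auto simp: fps_mult_nth intro!: sum.cong)
qed

text \<open>Divisibility by \<open>fps_X ^ n\<close> means agreement below degree n. This turns the
  finite identities, whose error terms have high order, into limits.\<close>

lemma tendsto_fps_dvd_diff:
  fixes f g :: "nat \<Rightarrow> 'a::comm_ring_1 fps"
  assumes "f \<longlonglongrightarrow> L" and dvd: "\<And>n. fps_X ^ n dvd g n - f n"
  shows "g \<longlonglongrightarrow> L"
proof (rule tendsto_fpsI)
  fix N
  have "eventually (\<lambda>n. f n $ N = L $ N) sequentially"
    using assms by (simp add: tendsto_fps_iff)
  with eventually_gt_at_top[of N] show "eventually (\<lambda>n. g n $ N = L $ N) sequentially"
  proof eventually_elim
    case (elim n)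
    obtain h where "g n = f n + fps_X ^ n * h"
      using dvd[of n] by (metis add.commute diff_add_cancel dvdE)
    then show ?case using elim by (simp add: fps_X_power_mult_nth)
  qed
qed

text \<open>Encodes the infinite sum of c k X^(e k). If \<open>k <= e k\<close> for all k, as for
  both exponent sequences used below, the cutoff \<open>k <= n\<close> loses no term.\<close>

definition theta :: "(nat \<Rightarrow> 'a::comm_ring_1) \<Rightarrow> (nat \<Rightarrow> nat) \<Rightarrow> 'a fps" where
  "theta c e = Abs_fps (\<lambda>n. \<Sum>k\<le>n. if e k = n then c k else 0)"

lemma theta_nth:
  assumes "\<And>k. k \<le> e k" and "n < m"
  shows "theta c e $ n = (\<Sum>k<m. if e k = n then c k else 0)"
proof -
  have "(\<Sum>k\<le>n. if e k = n then c k else 0) = (\<Sum>k<m. if e k = n then c k else 0)"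
  proof (rule sum.mono_neutral_left)
    show "\<forall>i\<in>{..<m} - {..n}. (if e i = n then c i else 0) = 0"
      using assms(1) by (metis DiffD2 atMost_iff)
  qed (use assms(2) in auto)
  then show ?thesis by (simp add: theta_def)
qed

lemma tendsto_theta:
  assumes "\<And>k. k \<le> e k"
  shows "(\<lambda>n. \<Sum>k<n. fps_const (c k) * fps_X ^ e k) \<longlonglongrightarrow> theta c e"
proof (rule tendsto_fpsI)
  fix N
  show "eventually (\<lambda>n. (\<Sum>k<n. fps_const (c k) * fps_X ^ e k) $ N = theta c e $ N) sequentially"
    using eventually_gt_at_top[of N]
    by eventually_elim
       (auto simp: theta_nth[OF assms] fps_sum_nth fps_X_power_iff intro!: sum.cong)
qed

lemma sum_lessThan_3_mult:
  fixes f :: "nat \<Rightarrow> 'a::comm_monoid_add"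
  shows "(\<Sum>k<3*m. f k) = (\<Sum>j<m. f (3*j) + f (3*j+1) + f (3*j+2))"
  by (induction m) (simp_all add: numeral_3_eq_3 numeral_2_eq_2 add.assoc)

text \<open>In Ramanujan's notation, \<open>psi\<close> is \<open>\<psi>(q)\<close>, but \<open>phi\<close> is \<open>\<phi>(-q\<^sup>2)\<close>.\<close>

definition psi :: "'a::comm_ring_1 fps" where
  "psi = theta (\<lambda>_. 1) triangle"

definition phi :: "'a::comm_ring_1 fps" where
  "phi = theta (\<lambda>k. if k = 0 then 1 else 2 * (-1) ^ k) (\<lambda>k. 2 * k\<^sup>2)"

section \<open>Sections of the two theta series\<close>

lemma le_triangle: "k \<le> triangle k"
  by (induction k) simp_all

lemma le_double_square: "k \<le> 2 * k\<^sup>2" for k :: nat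
  by (simp add: power2_eq_square)

lemma triangle_triple: "triangle (3*j) + 3*j = 9 * triangle j"
proof (induction j)
  case (Suc j)
  have "3 * Suc j = Suc (Suc (Suc (3 * j)))" by simp
  then show ?case using Suc by (simp only: triangle_Suc) simp
qed simp

lemma triangle_triple_plus:
  "triangle (3*j+1) = 9 * triangle j + 1" "triangle (3*j+2) = 9 * triangle j + 3 * j + 3"
  using triangle_triple[of j] by simp_all

text \<open>Write T for \<open>triangle\<close>. The index 3j+1 gives 9 T(j) + 1, while 3j and 3j+2
  give multiples of 3. So residue 2 never occurs, and residue 1 yields the exponents 3 T(j) of the
  dilation.\<close>

lemma trisect_psi:
  "trisect 1 psi = dilate (psi :: 'a::comm_ring_1 fps)"
  "trisect 2 psi = (0 :: 'a::comm_ring_1 fps)"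
proof -
  have nth: "(psi :: 'a fps) $ n = (\<Sum>j<m. (if triangle (3*j) = n then 1 else 0)
      + (if triangle (3*j+1) = n then 1 else 0) + (if triangle (3*j+2) = n then 1 else 0))"
    if "n < 3 * m" for n m
    unfolding psi_def theta_nth[of triangle, OF le_triangle that] sum_lessThan_3_mult ..
  define t where "t j = triangle (3*j) div 3" for j
  have tri: "triangle (3*j) = 3 * t j" "triangle (3*j+1) = 3 * (3 * triangle j) + 1"
    "triangle (3*j+2) = 3 * (3 * triangle j + j + 1)" for j
  proof -
    have "3 dvd triangle (3*j) + 3*j"
      unfolding triangle_triple by (rule dvd_mult2) simp
    then show "triangle (3*j) = 3 * t j"
      unfolding t_def by (simp add: dvd_add_left_iff)
    show "triangle (3*j+1) = 3 * (3 * triangle j) + 1" "triangle (3*j+2) = 3 * (3 * triangle j + j + 1)"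
      unfolding triangle_triple_plus by simp_all
  qed
  have ne: "3 * a \<noteq> 3 * n + 1" "3 * a \<noteq> 3 * n + 2" "3 * a + 1 \<noteq> 3 * n + 2" for a n :: nat
    by presburger+
  show "trisect 1 psi = (dilate psi :: 'a fps)"
  proof (rule fps_ext)
    fix n
    have "trisect 1 psi $ n = (\<Sum>j<Suc n. if 3 * triangle j = n then 1 else 0 :: 'a)"
      unfolding trisect_nth
      by (subst nth[of _ "Suc n"], simp)
         (intro sum.cong refl, simp only: tri ne if_False add_0_right add_0_left, auto)
    also have "\<dots> = dilate psi $ n"
    proof (cases "3 dvd n")
      case True
      then obtain m where "n = 3 * m" by blast
      then show ?thesis
        by (simp add: psi_def theta_nth[OF le_triangle, of _ "Suc n"]
                 del: sum.lessThan_Suc cong: if_cong)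
    next
      case False
      then show ?thesis by (auto simp del: sum.lessThan_Suc intro!: sum.neutral)
    qed
    finally show "trisect 1 psi $ n = (dilate psi :: 'a fps) $ n" .
  qed
  show "trisect 2 psi = (0 :: 'a fps)"
  proof (rule fps_ext)
    fix n
    show "trisect 2 psi $ n = (0 :: 'a fps) $ n"
      unfolding trisect_nth
      by (subst nth[of _ "Suc n"], simp)
         (simp only: tri ne if_False add_0_right sum.neutral_const fps_zero_nth)
  qed
qed

text \<open>Modulo 3, 2k^2 is 0 for k = 3j and 2 otherwise. A third of 2 (3j)^2 is 3 (2j^2), and the
  sign survives because (-1)^3 = -1.\<close>

lemma trisect_phi:
  "trisect 0 phi = dilate (phi :: 'a::comm_ring_1 fps)"
  "trisect 1 phi = (0 :: 'a::comm_ring_1 fps)"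
proof -
  define c where "c k = (if k = 0 then 1 else 2 * (-1) ^ k :: 'a)" for k :: nat
  have c: "c (3 * j) = c j" for j
    by (simp add: c_def power_mult)
  have nth: "(phi :: 'a fps) $ n = (\<Sum>j<m. (if 2 * (3*j)\<^sup>2 = n then c (3*j) else 0)
      + (if 2 * (3*j+1)\<^sup>2 = n then c (3*j+1) else 0) + (if 2 * (3*j+2)\<^sup>2 = n then c (3*j+2) else 0))"
    if "n < 3 * m" for n m
    unfolding phi_def c_def[abs_def, symmetric]
      theta_nth[of "\<lambda>k. 2 * k\<^sup>2", OF le_double_square that] sum_lessThan_3_mult ..
  have sq: "2 * (3*j)\<^sup>2 = 3 * (6 * j\<^sup>2)" "2 * (3*j+1)\<^sup>2 = 3 * (6 * j\<^sup>2 + 4 * j) + 2"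
    "2 * (3*j+2)\<^sup>2 = 3 * (6 * j\<^sup>2 + 8 * j + 2) + 2" for j :: nat
    by (simp_all add: power2_eq_square algebra_simps)
  have ne: "3 * a + 2 \<noteq> 3 * n" "3 * a + 2 \<noteq> 3 * n + 1" "3 * a \<noteq> 3 * n + 1" for a n :: nat
    by presburger+
  show "trisect 0 phi = (dilate phi :: 'a fps)"
  proof (rule fps_ext)
    fix n
    have "trisect 0 phi $ n = (\<Sum>j<Suc n. if 3 * (2 * j\<^sup>2) = n then c j else 0)"
      unfolding trisect_nth add_0_right
      by (subst nth[of _ "Suc n"], simp)
         (intro sum.cong refl, simp only: sq ne c if_False add_0_right, auto)
    also have "\<dots> = dilate phi $ n"
    proof (cases "3 dvd n")
      case True
      then obtain m where "n = 3 * m" by blast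
      then show ?thesis
        by (simp add: phi_def c_def theta_nth[OF le_double_square, of _ "Suc n"]
                 del: sum.lessThan_Suc cong: if_cong)
    next
      case False
      then show ?thesis by (auto simp del: sum.lessThan_Suc intro!: sum.neutral)
    qed
    finally show "trisect 0 phi $ n = (dilate phi :: 'a fps) $ n" .
  qed
  show "trisect 1 phi = (0 :: 'a fps)"
  proof (rule fps_ext)
    fix n
    show "trisect 1 phi $ n = (0 :: 'a fps) $ n"
      unfolding trisect_nth
      by (subst nth[of _ "Suc n"], simp) (simp only: sq ne if_False add_0_right sum.neutral_const fps_zero_nth)
  qed
qed

text \<open>Gauss' product for \<open>psi\<close>: in \<open>shanks_triangle\<close> at x = X the
  term \<open>s = 0\<close> is \<open>P n\<close> itself, and the terms with s >= 1 are divisible by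
  X^n.\<close>

lemma psi_limit:
  fixes P :: "nat \<Rightarrow> 'a::field fps"
  assumes P0: "P 0 = 1"
    and step: "\<And>n. P (Suc n) * (1 - fps_X ^ (2*n+1)) = P n * (1 - fps_X ^ (2*n+2))"
  shows "P \<longlonglongrightarrow> psi"
proof (rule tendsto_fps_dvd_diff)
  have "(\<lambda>n. \<Sum>k<n. fps_X ^ triangle k) \<longlonglongrightarrow> (psi :: 'a fps)"
    using tendsto_theta[OF le_triangle, of "\<lambda>_. 1 :: 'a"] by (simp add: psi_def)
  then show "(\<lambda>n. \<Sum>k<2*n. fps_X ^ triangle k) \<longlonglongrightarrow> (psi :: 'a fps)"
    by (rule filterlim_compose) (simp add: filterlim_subseq strict_mono_def)
  fix n
  have nz: "(fps_X :: 'a fps) ^ n \<noteq> 1" if "n > 0" for n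
    using that by (auto dest: arg_cong[of _ _ "\<lambda>f. f $ 0"])
  have "P n $ 0 = 1" for n
  proof (induction n)
    case (Suc n)
    then show ?case using arg_cong[OF step[of n], of "\<lambda>f. f $ 0"] by simp
  qed (simp add: P0)
  then have PR: "P n * inverse (P n) = 1" for n
    by (simp add: inverse_mult_eq_1')
  define t where "t s = inverse (P s) * fps_X ^ (s * (2*n+1))" for s
  have t0: "t 0 = 1" by (simp add: t_def P0)
  have "fps_X ^ n dvd (\<Sum>s\<in>{..<n} - {0}. P n * t s)"
  proof (rule dvd_sum)
    fix s assume "s \<in> {..<n} - {0}"
    then have "n \<le> s * (2*n+1)" by (cases s) auto
    then show "fps_X ^ n dvd P n * t s"
      unfolding t_def by (intro dvd_mult le_imp_power_dvd)
  qed
  show "fps_X ^ n dvd P n - (\<Sum>k<2*n. fps_X ^ triangle k)"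
  proof (cases "n = 0")
    case False
    have "(\<Sum>k<2*n. fps_X ^ triangle k) = (\<Sum>s<n. P n * t s)"
      using shanks_triangle[OF PR step nz, of n] by (simp add: t_def sum_distrib_left)
    also have "\<dots> = P n + (\<Sum>s\<in>{..<n} - {0}. P n * t s)"
      using False by (subst sum.remove[of _ 0]) (auto simp: t0)
    finally show ?thesis
      using \<open>fps_X ^ n dvd (\<Sum>s\<in>{..<n} - {0}. P n * t s)\<close> by simp
  qed simp
qed

text \<open>Gauss' product for \<open>phi\<close>: \<open>shanks_square\<close> at x = X^2, which
  doubles the squares in the exponents. The error terms contain x^((s+1)(n+1)).\<close>

lemma phi_limit:
  fixes Q :: "nat \<Rightarrow> 'a::field fps"
  assumes Q0: "Q 0 = 1"
    and step: "\<And>n. Q (Suc n) * (1 + fps_X ^ (2*n+2)) = Q n * (1 - fps_X ^ (2*n+2))"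
  shows "Q \<longlonglongrightarrow> phi"
proof (rule tendsto_fps_dvd_diff)
  define x where "x = (fps_X :: 'a fps)\<^sup>2"
  have x: "x ^ k = fps_X ^ (2*k)" for k
    by (simp add: x_def power_mult)
  define c where "c k = (if k = 0 then 1 else 2 * (-1) ^ k :: 'a)" for k :: nat
  have "fps_const (c (Suc k)) = 2 * (-1) ^ Suc k" for k
    by (simp only: c_def nat.distinct if_False numeral_fps_const fps_const_1_eq_1[symmetric]
             fps_const_neg fps_const_power fps_const_mult)
  then have sum: "(\<Sum>k<Suc n. fps_const (c k) * fps_X ^ (2 * k\<^sup>2))
      = 1 + 2 * (\<Sum>k<n. (-1) ^ Suc k * x ^ (Suc k)\<^sup>2)" for n
    by (simp only: sum.lessThan_Suc_shift x sum_distrib_left mult.assoc) (simp add: c_def)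
  have "(\<lambda>n. \<Sum>k<n. fps_const (c k) * fps_X ^ (2 * k\<^sup>2)) \<longlonglongrightarrow> (phi :: 'a fps)"
    using tendsto_theta[OF le_double_square, of c] by (simp only: phi_def c_def[abs_def])
  \<comment> \<open>The shift by one accounts for the term k = 0, which is the leading 1.\<close>
  from LIMSEQ_Suc[OF this]
  show "(\<lambda>n. 1 + 2 * (\<Sum>k<n. (-1) ^ Suc k * x ^ (Suc k)\<^sup>2)) \<longlonglongrightarrow> phi"
    unfolding sum .
  fix n
  have step': "Q (Suc n) * (1 + x ^ Suc n) = Q n * (1 - x ^ Suc n)" for n
    using step[of n] by (simp only: x mult_Suc_right) (simp add: add.commute)
  have nz: "1 + x ^ Suc n \<noteq> 0" for n
    unfolding x by (auto dest: arg_cong[of _ _ "\<lambda>f. f $ 0"])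
  have "Q n $ 0 = 1" for n
  proof (induction n)
    case (Suc n)
    then show ?case using arg_cong[OF step[of n], of "\<lambda>f. f $ 0"] by simp
  qed (simp add: Q0)
  then have QR: "Q n * inverse (Q n) = 1" for n
    by (simp add: inverse_mult_eq_1')
  define w where "w s = inverse (Q (s - 1)) * inverse (1 - x ^ s)" for s
  have w: "w (Suc s) * (1 - x ^ Suc s) = inverse (Q s)" for s
  proof -
    have "(1 - x ^ Suc s) $ 0 \<noteq> 0"
      unfolding x by simp
    from inverse_mult_eq_1[OF this] show ?thesis
      by (simp only: w_def mult.assoc diff_Suc_1 mult_1_right)
  qed
  have "Q n - (1 + 2 * (\<Sum>k<n. (-1) ^ Suc k * x ^ (Suc k)\<^sup>2))
      = - (Q n * (2 * (\<Sum>s<n. (-1) ^ Suc s * w (Suc s) * x ^ (Suc s * (n+1)))))"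
    using shanks_square[where R = "\<lambda>n. inverse (Q n)", OF Q0 QR w step' nz, of n]
    by (simp add: algebra_simps)
  moreover have "fps_X ^ n dvd x ^ (Suc s * (n+1))" for s
    unfolding x by (intro le_imp_power_dvd) simp
  ultimately show "fps_X ^ n dvd Q n - (1 + 2 * (\<Sum>k<n. (-1) ^ Suc k * x ^ (Suc k)\<^sup>2))"
    by (auto simp: dvd_minus_iff intro!: dvd_mult dvd_sum)
qed

section \<open>The generating function of PEND partitions\<close>

text \<open>\<open>A k\<close> holds the allowed multiplicities of \<open>k\<close>. Bounding the
  parts by \<open>m\<close> makes the generating function a finite product and permits induction on
  \<open>m\<close>.\<close>

definition restricted_partitions :: "(nat \<Rightarrow> nat set) \<Rightarrow> nat \<Rightarrow> nat \<Rightarrow> nat multiset set" where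
  "restricted_partitions A m N =
     {M. set_mset M \<subseteq> {1..m} \<and> (\<forall>k\<in>{1..m}. count M k \<in> A k) \<and> \<Sum>\<^sub># M = N}"

definition multiplicity_fps :: "(nat \<Rightarrow> nat set) \<Rightarrow> nat \<Rightarrow> 'a::comm_ring_1 fps" where
  "multiplicity_fps A k = Abs_fps (\<lambda>i. if k dvd i \<and> i div k \<in> A k then 1 else 0)"

lemma multiplicity_fps_nth: "multiplicity_fps A k $ i = (if k dvd i \<and> i div k \<in> A k then 1 else 0)"
  by (simp add: multiplicity_fps_def)

lemma finite_restricted_partitions: "finite (restricted_partitions A m N)"
  by (rule finite_subset[OF _ finite_partitions[of N]])
     (auto simp: restricted_partitions_def is_partition_def intro!: gr0I)

text \<open>The sorting is by the total weight \<open>i\<close> of the copies of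
  \<open>Suc m\<close>, not by their number, so that the union matches the Cauchy product.\<close>

lemma restricted_partitions_Suc:
  "restricted_partitions A (Suc m) N =
     (\<Union>i\<in>{i\<in>{0..N}. Suc m dvd i \<and> i div Suc m \<in> A (Suc m)}.
        (\<lambda>M. M + replicate_mset (i div Suc m) (Suc m)) ` restricted_partitions A m (N - i))"
  (is "?L = ?R")
proof
  show "?L \<subseteq> ?R"
  proof
    fix M assume "M \<in> ?L"
    then have M: "set_mset M \<subseteq> {1..Suc m}" "\<And>k. k \<in> {1..Suc m} \<Longrightarrow> count M k \<in> A k" "\<Sum>\<^sub># M = N"
      by (auto simp: restricted_partitions_def)
    define j where "j = count M (Suc m)"
    define M' where "M' = filter_mset (\<lambda>k. k \<noteq> Suc m) M"
    have split: "M = M' + replicate_mset j (Suc m)"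
      by (rule multiset_eqI) (auto simp: M'_def j_def)
    then have sum: "N = \<Sum>\<^sub># M' + j * Suc m"
      using M(3) by (auto simp: sum_mset_replicate_mset)
    have "set_mset M' \<subseteq> {1..m}"
      using M(1) by (auto simp: M'_def le_Suc_eq dest!: subsetD)
    moreover have "count M' k \<in> A k" if "k \<in> {1..m}" for k
      using M(2)[of k] that by (simp add: M'_def)
    ultimately have "M' \<in> restricted_partitions A m (N - j * Suc m)"
      using sum by (auto simp: restricted_partitions_def)
    moreover have "j * Suc m \<in> {i\<in>{0..N}. Suc m dvd i \<and> i div Suc m \<in> A (Suc m)}"
      using sum M(2)[of "Suc m"] by (auto simp: j_def simp del: mult_Suc_right)
    moreover have "j * Suc m div Suc m = j"
      by (simp del: mult_Suc_right)
    ultimately show "M \<in> ?R"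
      using split by (intro UN_I[of "j * Suc m"] image_eqI[of _ _ M']) simp_all
  qed
  show "?R \<subseteq> ?L"
  proof
    fix M assume "M \<in> ?R"
    then obtain i M' where i: "i \<le> N" "Suc m dvd i" "i div Suc m \<in> A (Suc m)"
      and M': "M' \<in> restricted_partitions A m (N - i)"
      and M: "M = M' + replicate_mset (i div Suc m) (Suc m)"
      by auto
    have set: "set_mset M' \<subseteq> {1..m}" and sum: "\<Sum>\<^sub># M' = N - i"
      and cnt: "\<And>k. k \<in> {1..m} \<Longrightarrow> count M' k \<in> A k"
      using M' by (auto simp: restricted_partitions_def)
    have "Suc m \<notin># M'" using set by auto
    then have "count M k \<in> A k" if "k \<in> {1..Suc m}" for k
      using that i(3) cnt by (cases "k = Suc m") (auto simp: M not_in_iff)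
    moreover have "set_mset M \<subseteq> {1..Suc m}"
      using set by (auto simp: M split: if_splits)
    moreover have "\<Sum>\<^sub># M = N"
      using i(1,2) by (simp add: M sum sum_mset_replicate_mset del: mult_Suc_right)
    ultimately show "M \<in> ?L"
      by (simp add: restricted_partitions_def)
  qed
qed

lemma card_restricted_partitions:
  "(\<Prod>k=1..m. multiplicity_fps A k :: 'a::comm_ring_1 fps) $ N = of_nat (card (restricted_partitions A m N))"
proof (induction m arbitrary: N)
  case 0
  have "restricted_partitions A 0 N = (if N = 0 then {{#}} else {})"
    by (auto simp: restricted_partitions_def)
  then show ?case by simp
next
  case (Suc m)
  let ?k = "Suc m"
  let ?I = "{i\<in>{0..N}. ?k dvd i \<and> i div ?k \<in> A ?k}"
  let ?f = "\<lambda>i M. M + replicate_mset (i div ?k) ?k"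
  \<comment> \<open>The multiplicity of \<open>Suc m\<close> recovers \<open>i\<close>, so the
    pieces of the union are disjoint.\<close>
  have count: "count (?f i M) ?k = i div ?k" if "M \<in> restricted_partitions A m N'" for i M N'
  proof -
    have "?k \<notin># M" using that by (auto simp: restricted_partitions_def)
    then show ?thesis by (simp add: not_in_iff)
  qed
  have disj: "?f i ` restricted_partitions A m (N - i) \<inter> ?f i' ` restricted_partitions A m (N - i') = {}"
    if "i \<in> ?I" "i' \<in> ?I" "i \<noteq> i'" for i i'
  proof -
    have "i div ?k \<noteq> i' div ?k"
      using that by (metis (no_types, lifting) dvd_mult_div_cancel mem_Collect_eq)
    then show ?thesis using count by (auto simp del: count_union) (metis count)
  qed
  have "card (restricted_partitions A ?k N) = (\<Sum>i\<in>?I. card (?f i ` restricted_partitions A m (N - i)))"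
    unfolding restricted_partitions_Suc
    using disj by (intro card_UN_disjoint) (auto simp: finite_restricted_partitions)
  also have "\<dots> = (\<Sum>i\<in>?I. card (restricted_partitions A m (N - i)))"
    by (intro sum.cong refl card_image) (auto simp: inj_on_def)
  finally have "of_nat (card (restricted_partitions A ?k N))
      = (\<Sum>i\<in>?I. (\<Prod>k=1..m. multiplicity_fps A k) $ (N - i) :: 'a)"
    by (simp only: of_nat_sum Suc.IH)
  also have "\<dots> = (\<Sum>i=0..N. multiplicity_fps A ?k $ i * (\<Prod>k=1..m. multiplicity_fps A k) $ (N - i))"
    unfolding sum.inter_filter[OF finite_atLeastAtMost]
    by (intro sum.cong refl) (simp add: multiplicity_fps_nth)
  also have "\<dots> = (\<Prod>k=1..?k. multiplicity_fps A k) $ N"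
    by (simp add: fps_mult_nth[symmetric] prod.nat_ivl_Suc' mult.commute)
  finally show ?case by simp
qed

definition pend_mults :: "nat \<Rightarrow> nat set" where
  "pend_mults k = (if even k then - {1} else UNIV)"

lemma pend_eq_card:
  assumes "n \<le> m"
  shows "pend n = card (restricted_partitions pend_mults m n)"
proof -
  have "k \<le> m" if "k \<in># M" "\<Sum>\<^sub># M = n" for k M
  proof -
    have "k \<le> \<Sum>\<^sub># M"
      unfolding sum_mset.remove[OF that(1)] by simp
    then show ?thesis using that(2) assms by simp
  qed
  then have "is_partition n M \<longleftrightarrow> set_mset M \<subseteq> {1..m} \<and> \<Sum>\<^sub># M = n" for M
    by (force simp: is_partition_def)
  moreover have "is_PEND M \<longleftrightarrow> (\<forall>k\<in>{1..m}. count M k \<in> pend_mults k)"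
    if "set_mset M \<subseteq> {1..m}" for M
  proof -
    \<comment> \<open>Multiplicity 1 forces membership, and multiplicity 0 is always allowed, so the
      quantifier may range over all \<open>k\<close>.\<close>
    have "is_PEND M \<longleftrightarrow> (\<forall>k. count M k \<in> pend_mults k)"
    proof -
      have "k \<in># M" if "count M k = 1" for k
        by (rule count_inI) (simp add: that)
      then show ?thesis
        unfolding is_PEND_def pend_mults_def by auto
    qed
    moreover have "count M k \<in> pend_mults k" if "k \<notin> {1..m}" for k
    proof -
      have "count M k = 0"
        using that \<open>set_mset M \<subseteq> {1..m}\<close> by (auto simp: count_eq_zero_iff)
      then show ?thesis by (simp add: pend_mults_def)
    qed
    ultimately show ?thesis by blast
  qed
  ultimately have "{M. is_partition n M \<and> is_PEND M} = restricted_partitions pend_mults m n"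
    by (auto simp only: restricted_partitions_def)
  then show ?thesis by (simp add: pend_def)
qed

definition pend_fps :: "'a::comm_ring_1 fps" where
  "pend_fps = Abs_fps (\<lambda>n. of_nat (pend n))"

lemma pend_fps_limit:
  "(\<lambda>m. \<Prod>k=1..m. multiplicity_fps pend_mults k) \<longlonglongrightarrow> pend_fps"
proof (rule tendsto_fpsI)
  fix n
  show "eventually (\<lambda>m. (\<Prod>k=1..m. multiplicity_fps pend_mults k) $ n = pend_fps $ n) sequentially"
    using eventually_ge_at_top[of n]
    by eventually_elim (simp only: card_restricted_partitions pend_fps_def pend_eq_card fps_nth_Abs_fps)
qed

section \<open>The factor contributed by each part size\<close>

lemma geometric_fps:
  assumes "k > 0"
  shows "Abs_fps (\<lambda>i. if k dvd i then 1 else 0) * (1 - fps_X ^ k) = (1 :: 'a::comm_ring_1 fps)"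
proof (rule fps_ext)
  fix n
  have "k dvd n - k \<longleftrightarrow> k dvd n" if "n \<ge> k"
    using that by (simp add: dvd_minus_self)
  moreover have "\<not> k dvd n" if "n < k" "n > 0"
    using that by (simp add: nat_dvd_not_less)
  ultimately show "(Abs_fps (\<lambda>i. if k dvd i then 1 else 0) * (1 - fps_X ^ k)) $ n = (1 :: 'a fps) $ n"
    using assms by (simp add: right_diff_distrib fps_X_power_mult_right_nth)
qed

lemma multiplicity_fps_odd:
  assumes "odd k"
  shows "multiplicity_fps pend_mults k * (1 - fps_X ^ k) = 1"
  using geometric_fps[OF odd_pos[OF assms]] assms by (simp add: multiplicity_fps_def pend_mults_def)

text \<open>Forbidding multiplicity 1 removes the single term X^k from the geometric series.\<close>

lemma multiplicity_fps_even:
  assumes "even k" "k > 0"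
  shows "multiplicity_fps pend_mults k * (1 - fps_X ^ k) = (1 - fps_X ^ k + (fps_X ^ k)\<^sup>2 :: 'a::comm_ring_1 fps)"
proof -
  have "multiplicity_fps pend_mults k = (Abs_fps (\<lambda>i. if k dvd i then 1 else 0) - fps_X ^ k :: 'a fps)"
    using assms by (auto simp: multiplicity_fps_def pend_mults_def fps_eq_iff fps_X_power_iff)
  then show ?thesis
    using geometric_fps[OF assms(2), where 'a = 'a]
    by (simp add: left_diff_distrib) (simp add: right_diff_distrib power2_eq_square)
qed

section \<open>The congruence\<close>

text \<open>With y = X^(2n+2), the step from n to n+1 brings 1 / (1 - X^(2n+1)) and (1 + y)^2 / (1 -
  y) into the product, and (1 - y)^2 / (1 + y)^2 from \<open>Q\<close> squared. The net factor is
  that of \<open>psi_limit\<close>.\<close>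

lemma pend_fps_times_phi:
  assumes three: "(3 :: 'a::field) = 0"
  shows "pend_fps * phi\<^sup>2 = (psi :: 'a fps)"
proof -
  define E where "E m = (\<Prod>k=1..m. multiplicity_fps pend_mults k :: 'a fps)" for m
  define Q where "Q n = (\<Prod>i<n. (1 - fps_X ^ (2*i+2)) * inverse (1 + fps_X ^ (2*i+2)) :: 'a fps)" for n
  define P where "P n = E (2*n) * (Q n)\<^sup>2" for n
  have Qstep: "Q (Suc n) * (1 + fps_X ^ (2*n+2)) = Q n * (1 - fps_X ^ (2*n+2))" for n
  proof -
    have "(1 + fps_X ^ (2*n+2) :: 'a fps) $ 0 \<noteq> 0" by simp
    from inverse_mult_eq_1[OF this] show ?thesis
      by (simp only: Q_def prod.lessThan_Suc mult.assoc mult_1_right)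
  qed
  have Pstep: "P (Suc n) * (1 - fps_X ^ (2*n+1)) = P n * (1 - fps_X ^ (2*n+2))" for n
  proof -
    define y where "y = (fps_X :: 'a fps) ^ (2*n+2)"
    define b where "b = (1 - fps_X ^ (2*n+1) :: 'a fps)"
    define U V where "U = (multiplicity_fps pend_mults (2*n+1) :: 'a fps)"
      and "V = (multiplicity_fps pend_mults (2*n+2) :: 'a fps)"
    have U: "U * b = 1"
      unfolding U_def b_def by (rule multiplicity_fps_odd) simp
    have "(3 :: 'a fps) = 0"
      using three by (simp add: numeral_fps_const)
    \<comment> \<open>The two sides differ by \<open>3 * y\<close>; here characteristic 3
      enters.\<close>
    then have "1 - y + y\<^sup>2 = (1 + y)\<^sup>2"
      by (simp add: power2_eq_square algebra_simps)
    then have V: "V * (1 - y) = (1 + y)\<^sup>2"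
      unfolding V_def y_def by (subst multiplicity_fps_even) simp_all
    have Q: "Q (Suc n) * (1 + y) = Q n * (1 - y)"
      using Qstep by (simp add: y_def)
    have "E (2 * Suc n) = E (2*n) * U * V"
      by (simp add: E_def U_def V_def)
    then have "(P (Suc n) * b) * (1 - y) = E (2*n) * (U * b) * (V * (1 - y)) * (Q (Suc n))\<^sup>2"
      by (simp only: P_def ac_simps)
    also have "\<dots> = E (2*n) * (Q (Suc n) * (1 + y))\<^sup>2"
      by (simp only: U V mult_1_left mult_1_right power_mult_distrib ac_simps)
    also have "\<dots> = (P n * (1 - y)) * (1 - y)"
      unfolding Q by (simp only: P_def power2_eq_square ac_simps)
    finally have "(P (Suc n) * b) * (1 - y) = (P n * (1 - y)) * (1 - y)" .
    moreover have "1 - y \<noteq> 0"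
      unfolding y_def by (auto dest: arg_cong[of _ _ "\<lambda>f. f $ 0"])
    ultimately show ?thesis
      unfolding b_def y_def by (metis mult_right_cancel)
  qed
  have "P \<longlonglongrightarrow> psi"
    by (rule psi_limit[OF _ Pstep]) (simp add: P_def E_def Q_def)
  moreover have "Q \<longlonglongrightarrow> phi"
    by (rule phi_limit[OF _ Qstep]) (simp add: Q_def)
  moreover have "(\<lambda>n. E (2*n)) \<longlonglongrightarrow> pend_fps"
    unfolding E_def by (rule filterlim_compose[OF pend_fps_limit])
      (simp add: filterlim_subseq strict_mono_def)
  ultimately have "P \<longlonglongrightarrow> pend_fps * (phi * phi)"
    unfolding P_def power2_eq_square by (intro tendsto_fps_mult)
  from LIMSEQ_unique[OF this \<open>P \<longlonglongrightarrow> psi\<close>] show ?thesis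
    by (simp add: power2_eq_square)
qed

lemma pend_fps_section:
  assumes three: "(3 :: 'a::field) = 0" and cube: "\<And>a :: 'a. a ^ 3 = a"
  shows "trisect 2 (trisect 0 (trisect 1 pend_fps)) = (0 :: 'a fps)"
proof -
  let ?F = "pend_fps :: 'a fps"
  have dil: "dilate f = f ^ 3" for f :: "'a fps"
    using cube_eq_dilate[OF three cube] by simp
  have "dilate phi * ?F = psi * phi"
    by (simp add: pend_fps_times_phi[OF three, symmetric] dil power2_eq_square power3_eq_cube mult_ac)
  then have "phi * trisect 1 ?F = trisect 1 (psi * phi)"
    by (metis trisect_dilate_mult one_less_numeral_iff semiring_norm(77))
  \<comment> \<open>Of the terms of \<open>trisect_mult\<close> only
    \<open>trisect 1 psi * trisect 0 phi\<close> survives, and \<open>trisect 0 phi\<close> is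
    phi^3, which supplies a \<open>phi\<close> to cancel.\<close>
  also have "\<dots> = phi * (dilate psi * phi\<^sup>2)"
    by (simp only: trisect_mult trisect_psi trisect_phi)
       (simp add: dil power2_eq_square power3_eq_cube mult_ac)
  finally have "phi * trisect 1 ?F = phi * (dilate psi * phi\<^sup>2)" .
  moreover have "(phi :: 'a fps) $ 0 = 1"
    by (simp add: phi_def theta_def)
  ultimately have "trisect 1 ?F = dilate psi * phi\<^sup>2"
    by (metis fps_zero_nth mult_left_cancel zero_neq_one)
  then have "trisect 0 (trisect 1 ?F) = psi * trisect 0 (phi * phi)"
    by (simp add: trisect_dilate_mult power2_eq_square)
  also have "\<dots> = dilate phi * (dilate phi * psi)"
    by (simp only: trisect_mult trisect_phi) simp
  finally show ?thesis
    by (simp add: trisect_dilate_mult trisect_psi)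
qed

text \<open>\<open>mod_ring\<close> takes its modulus from the cardinality of a type, so three
  elements of prime cardinality give the field with three elements.\<close>

datatype three = Zero | One | Two

lemma UNIV_three: "UNIV = {Zero, One, Two}"
  using three.exhaust by auto

instance three :: finite
  by standard (simp add: UNIV_three)

lemma card_three: "CARD(three) = 3"
  by (simp add: UNIV_three)

instance three :: prime_card
  by standard (simp add: card_three)

lemma three_mod_ring: "(3 :: three mod_ring) = 0" "a ^ 3 = (a :: three mod_ring)"
  "of_nat n = (0 :: three mod_ring) \<longleftrightarrow> 3 dvd n"
proof -
  have char: "of_nat n = (0 :: three mod_ring) \<longleftrightarrow> 3 dvd n" for n
    using of_nat_eq_0_iff_char_dvd[where 'a = "three mod_ring", of n] by (simp add: card_three)
  show "of_nat n = (0 :: three mod_ring) \<longleftrightarrow> 3 dvd n" by (rule char)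
  show three: "(3 :: three mod_ring) = 0"
    using char[of 3] by simp
  obtain i where i: "i < 3" "a = of_nat i"
    using surj_of_nat_mod_ring[of a] by (auto simp: card_three)
  have "i = 0 \<or> i = 1 \<or> i = 2" using i(1) by auto
  then have "3 dvd i ^ 3 - i" by auto
  \<comment> \<open>Guards the truncated subtraction when the divisibility is carried over to the
    field.\<close>
  moreover have "i \<le> i ^ 3" by (cases i) (auto simp: power3_eq_cube)
  ultimately show "a ^ 3 = a"
    using char[of "i ^ 3 - i"] by (simp add: i(2) of_nat_diff)
qed

theorem theorem2:
  fixes n :: nat
  shows "[pend (27 * n + 19) = 0] (mod 3)"
proof -
  have "trisect 2 (trisect 0 (trisect 1 pend_fps)) $ n = (0 :: three mod_ring fps) $ n"
    using pend_fps_section[OF three_mod_ring(1,2)] by simp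
  \<comment> \<open>The sections compose to the index 3 (3 (3n + 2) + 0) + 1 = 27n + 19.\<close>
  then have "of_nat (pend (27 * n + 19)) = (0 :: three mod_ring)"
    by (simp add: pend_fps_def algebra_simps)
  then show ?thesis
    by (simp add: three_mod_ring(3) cong_0_iff)
qed

end
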